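(* Let $\omega$ be irrational and let $f:\mathbb{T}^2\to\mathbb{T}^2$, $f(\theta,\xi)=(\theta+\omega,f_\theta(\xi))$, be a quasiperiodically forced circle homeomorphism which is homotopic to the identity and $\rho$-unbounded. Then $f$ has sensitive dependence on initial conditions on $\mathbb{T}^2$.
   Context: $\mathbb{T}=\mathbb{R}/\mathbb{Z}$ is the circle. A quasiperiodically forced circle homeomorphism is a continuous map $f:\mathbb{T}^2\to\mathbb{T}^2$ of the form $f(\theta,\xi)=(\theta+\omega,f_\theta(\xi))$ with $\omega$ irrational, such that each fiber map $f_\theta:\mathbb{T}\to\mathbb{T}$ is a homeomorphism. If $f$ is homotopic to the identity, it has a continuous lift $F:\mathbb{T}\times\mathbb{R}\to\mathbb{T}\times\mathbb{R}$; write $F^n_\theta(\xi)$ for the second coordinate of $F^n(\theta,\xi)$. By a theorem of Herman the limit $\rho_F:=\lim_{n\to\infty}\frac1n(F^n_\theta(\xi)-\xi)$ exists and is independent of $(\theta,\xi)\in\mathbb{T}\times\mathbb{R}$. $f$ is called $\rho$-bounded if the quantities $|F^n_\theta(\xi)-\xi-n\rho_F|$ are bounded uniformly in $\theta$, $\xi$ and $n\in\mathbb{N}$, and $\rho$-unbounded otherwise (this does not depend on the lift). A map $g:Y\to Y$ of a metric space $(Y,d)$ has sensitive dependence on initial conditions if there is $\varepsilon>0$ such that for all $\delta>0$ and $x\in Y$ there exist $n\ge 0$ and $y\in Y$ with $d(x,y)<\delta$ and $d(g^n(x),g^n(y))>\varepsilon$. *)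

theory Defs
  imports "HOL-Analysis.Analysis"
begin

section \<open>The circle as the quotient of the reals by the integers\<close>

quotient_type circle = real / "\<lambda>x y :: real. x - y \<in> \<int>"
  morphisms rep_circle to_circle
proof (rule equivpI)
  show "reflp (\<lambda>x y :: real. x - y \<in> \<int>)"
    by (rule reflpI) simp
  show "symp (\<lambda>x y :: real. x - y \<in> \<int>)"
    by (rule sympI) (metis Ints_minus minus_diff_eq)
  show "transp (\<lambda>x y :: real. x - y \<in> \<int>)"
    by (rule transpI) (metis Ints_add diff_add_cancel add_diff_eq)
qed

instantiation circle :: ab_group_add
begin

lift_definition zero_circle :: circle is "0 :: real" .

lift_definition plus_circle :: "circle \<Rightarrow> circle \<Rightarrow> circle" is "(+)"
  by (metis Ints_add add_diff_add)

lift_definition minus_circle :: "circle \<Rightarrow> circle \<Rightarrow> circle" is "(-)"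
  by (metis Ints_diff diff_diff_eq2 diff_diff_eq diff_add_eq add.commute)

lift_definition uminus_circle :: "circle \<Rightarrow> circle" is "uminus"
  by (metis Ints_minus minus_diff_minus)

instance
  by standard (transfer, simp)+

end

lemma abs_diff_round_le: "\<bar>x - of_int (round x)\<bar> \<le> \<bar>x - of_int k\<bar>" for x :: real
  by (metis abs_minus_commute round_diff_minimal)

lemma abs_diff_round_eq:
  fixes x y :: real
  assumes "x - y \<in> \<int>"
  shows "\<bar>x - of_int (round x)\<bar> = \<bar>y - of_int (round y)\<bar>"
proof -
  obtain m :: int where m: "x - y = of_int m"
    using assms by (auto elim: Ints_cases)
  have "\<bar>x - of_int (round x)\<bar> \<le> \<bar>x - of_int (round y + m)\<bar>"
    by (rule abs_diff_round_le)
  moreover have "\<bar>y - of_int (round y)\<bar> \<le> \<bar>y - of_int (round x - m)\<bar>"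
    by (rule abs_diff_round_le)
  moreover have "x - of_int (round y + m) = y - of_int (round y)"
    "y - of_int (round x - m) = x - of_int (round x)"
    using m by simp_all
  ultimately show ?thesis by simp
qed

text \<open>The metric is the distance to the nearest integer of a difference of
  representatives; by \<open>open_circle_iff\<close> below it induces the quotient topology.\<close>

instantiation circle :: metric_space
begin

lift_definition dist_circle :: "circle \<Rightarrow> circle \<Rightarrow> real"
  is "\<lambda>x y. \<bar>(x - y) - of_int (round (x - y))\<bar>"
proof -
  fix x x' y y' :: real
  assume "x - x' \<in> \<int>" "y - y' \<in> \<int>"
  then have "(x - x') - (y - y') \<in> \<int>" by (rule Ints_diff)
  then have "(x - y) - (x' - y') \<in> \<int>" by (simp add: algebra_simps)
  then show "\<bar>(x - y) - of_int (round (x - y))\<bar> = \<bar>(x' - y') - of_int (round (x' - y'))\<bar>"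
    by (rule abs_diff_round_eq)
qed

definition uniformity_circle :: "(circle \<times> circle) filter"
  where "uniformity_circle = (INF e\<in>{0 <..}. principal {(x, y). dist x y < e})"

definition open_circle :: "circle set \<Rightarrow> bool"
  where "open_circle U \<longleftrightarrow> (\<forall>x\<in>U. eventually (\<lambda>(x', y). x' = x \<longrightarrow> y \<in> U) uniformity)"

instance
proof
  show "uniformity = (INF e\<in>{0 <..}. principal {(x, y :: circle). dist x y < e})"
    by (rule uniformity_circle_def)
  show "open U \<longleftrightarrow> (\<forall>x\<in>U. eventually (\<lambda>(x', y). x' = x \<longrightarrow> y \<in> U) uniformity)"
    for U :: "circle set"
    by (rule open_circle_def)
  show "dist x y = 0 \<longleftrightarrow> x = y" for x y :: circle
  proof (transfer)
    fix x y :: real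
    show "\<bar>(x - y) - of_int (round (x - y))\<bar> = 0 \<longleftrightarrow> x - y \<in> \<int>"
      by (metis Ints_cases Ints_of_int abs_0 abs_eq_0 diff_self eq_iff_diff_eq_0 round_of_int)
  qed
  show "dist x y \<le> dist x z + dist y z" for x y z :: circle
  proof (transfer)
    fix x y z :: real
    have "\<bar>(x - y) - of_int (round (x - y))\<bar>
        \<le> \<bar>(x - y) - of_int (round (x - z) - round (y - z))\<bar>"
      by (rule abs_diff_round_le)
    also have "\<dots> \<le> \<bar>(x - z) - of_int (round (x - z))\<bar> + \<bar>(y - z) - of_int (round (y - z))\<bar>"
      by simp
    finally show "\<bar>(x - y) - of_int (round (x - y))\<bar>
      \<le> \<bar>(x - z) - of_int (round (x - z))\<bar> + \<bar>(y - z) - of_int (round (y - z))\<bar>" .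
  qed
qed

end

lemma to_circle_eq_iff: "to_circle x = to_circle y \<longleftrightarrow> x - y \<in> \<int>"
  by (rule circle.abs_eq_iff)

lemma surj_to_circle: "surj to_circle"
  by (metis Quotient_circle Quotient_abs_rep surjI)

lemma dist_to_circle:
  "dist (to_circle x) (to_circle y) = \<bar>(x - y) - of_int (round (x - y))\<bar>"
  by (rule dist_circle.abs_eq)

lemma dist_to_circle_le: "dist (to_circle x) (to_circle y) \<le> dist x y"
  using abs_diff_round_le[of "x - y" 0] by (simp add: dist_to_circle dist_real_def)

lemma open_circle_iff: "open U \<longleftrightarrow> open (to_circle -` U)"
proof
  have "continuous_on UNIV to_circle"
    unfolding continuous_on_iff using dist_to_circle_le by (meson le_less_trans)
  then show "open U \<Longrightarrow> open (to_circle -` U)"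
    by (simp add: open_vimage)
next
  assume o: "open (to_circle -` U)"
  show "open U"
    unfolding open_dist
  proof
    fix u assume "u \<in> U"
    then obtain x where x: "u = to_circle x" "x \<in> to_circle -` U"
      by (metis surjD[OF surj_to_circle] vimageI)
    then obtain e where e: "e > 0" "\<And>y. dist y x < e \<Longrightarrow> y \<in> to_circle -` U"
      using o unfolding open_dist by blast
    have "v \<in> U" if v: "dist v u < e" for v
    proof -
      obtain y where y: "v = to_circle y"
        by (metis surjD[OF surj_to_circle])
      let ?y = "y - of_int (round (y - x))"
      have "to_circle ?y = v"
        unfolding y to_circle_eq_iff by simp
      moreover have "dist ?y x < e"
        using v unfolding y x(1) dist_to_circle by (simp add: dist_real_def algebra_simps)
      ultimately show ?thesis using e(2) by fastforce
    qed
    then show "\<exists>e>0. \<forall>v. dist v u < e \<longrightarrow> v \<in> U" using e(1) by blast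
  qed
qed

section \<open>Quasiperiodically forced circle homeomorphisms\<close>

definition qpf_circle_homeo :: "real \<Rightarrow> (circle \<times> circle \<Rightarrow> circle \<times> circle) \<Rightarrow> bool"
  where "qpf_circle_homeo \<omega> f \<longleftrightarrow>
    \<omega> \<notin> \<rat> \<and>
    continuous_on UNIV f \<and>
    (\<forall>\<theta> \<xi>. fst (f (\<theta>, \<xi>)) = \<theta> + to_circle \<omega>) \<and>
    (\<forall>\<theta>. \<exists>h. homeomorphism UNIV UNIV (\<lambda>\<xi>. snd (f (\<theta>, \<xi>))) h)"

definition is_lift :: "(circle \<times> real \<Rightarrow> circle \<times> real) \<Rightarrow> (circle \<times> circle \<Rightarrow> circle \<times> circle) \<Rightarrow> bool"
  where "is_lift F f \<longleftrightarrow>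
    continuous_on UNIV F \<and> map_prod id to_circle \<circ> F = f \<circ> map_prod id to_circle"

text \<open>The description is meaningful for lifts of quasiperiodically forced circle
  homeomorphisms homotopic to the identity, by Herman's theorem.\<close>

definition rotation_number :: "(circle \<times> real \<Rightarrow> circle \<times> real) \<Rightarrow> real"
  where "rotation_number F =
    (THE \<rho>. \<forall>\<theta> \<xi>. (\<lambda>n. (snd ((F ^^ n) (\<theta>, \<xi>)) - \<xi>) / real n) \<longlonglongrightarrow> \<rho>)"

text \<open>Two lifts of the same map differ by an integer translation of the fibres, so the
  choice of the lift is immaterial. The notion is only used for maps homotopic to the
  identity, which do have a lift.\<close>

definition rho_bounded :: "(circle \<times> circle \<Rightarrow> circle \<times> circle) \<Rightarrow> bool"
  where "rho_bounded f \<longleftrightarrow>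
    (\<exists>F. is_lift F f \<and>
      (\<exists>C. \<forall>\<theta> \<xi> n. \<bar>snd ((F ^^ n) (\<theta>, \<xi>)) - \<xi> - real n * rotation_number F\<bar> \<le> C))"

abbreviation rho_unbounded :: "(circle \<times> circle \<Rightarrow> circle \<times> circle) \<Rightarrow> bool"
  where "rho_unbounded f \<equiv> \<not> rho_bounded f"

definition sensitive_dependence :: "('a::metric_space \<Rightarrow> 'a) \<Rightarrow> bool"
  where "sensitive_dependence g \<longleftrightarrow>
    (\<exists>\<epsilon>>0. \<forall>\<delta>>0. \<forall>x. \<exists>n y. dist x y < \<delta> \<and> dist ((g ^^ n) x) ((g ^^ n) y) > \<epsilon>)"

end

theory Submission
  imports Defs
begin

text \<open>A homotopy from the identity to \<open>f\<close> can be cut into finitely many small steps, and adding up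
  the steps gives a real-valued displacement and with it a lift \<open>F\<close> of \<open>f\<close>. Suppose that there is
  no sensitive dependence. Then some orbit is shadowed, up to \<open>1/4\<close>, by all orbits that start in
  a neighbourhood of its initial point; by continuity in \<open>\<theta>\<close> this remains true for the lift on an
  interval of base points. As every base point reaches this interval in a bounded number of steps
  and \<open>F\<^sup>n\<close> is monotone on fibres and commutes with integer translations, the oscillation of the
  displacement \<open>F\<^sup>n\<^sub>\<theta>(\<xi>) - \<xi>\<close> is bounded uniformly in \<open>n\<close>. Hence
  the displacement along one orbit is an almost additive sequence, so it stays at bounded
  distance from \<open>n \<rho>\<close> for some \<open>\<rho>\<close>, which is then the rotation number. Herman's theorem is not
  used.\<close>

section \<open>The circle\<close>

lemma to_circle_add: "to_circle (x + y) = to_circle x + to_circle y"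
  by (rule plus_circle.abs_eq[symmetric])

lemma to_circle_diff: "to_circle (x - y) = to_circle x - to_circle y"
  by (rule minus_circle.abs_eq[symmetric])

lemma to_circle_0: "to_circle 0 = 0"
  by (rule zero_circle.abs_eq[symmetric])

lemma to_circle_of_int [simp]: "to_circle (of_int k) = 0"
  by (simp add: to_circle_0[symmetric] to_circle_eq_iff)

lemma to_circle_add_of_int [simp]: "to_circle (x + of_int k) = to_circle x"
  by (simp add: to_circle_add)

lemma continuous_on_to_circle: "continuous_on A to_circle"
  unfolding continuous_on_iff using dist_to_circle_le by (meson le_less_trans)

lemmas continuous_on_to_circle_compose [continuous_intros] =
  continuous_on_compose2[OF continuous_on_to_circle[of UNIV] _ subset_UNIV]

lemma compact_UNIV_circle: "compact (UNIV :: circle set)"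
proof -
  have "c \<in> to_circle ` {0..1}" for c
  proof -
    obtain x where x: "c = to_circle x"
      by (metis surjD[OF surj_to_circle])
    have "to_circle (frac x) = c"
      unfolding x to_circle_eq_iff frac_def by simp
    moreover have "frac x \<in> {0..1}"
      by (simp add: frac_lt_1 less_imp_le)
    ultimately show ?thesis by blast
  qed
  then have "UNIV = to_circle ` {0..1}" by blast
  then show ?thesis
    by (metis compact_Icc compact_continuous_image continuous_on_to_circle)
qed

text \<open>Translation invariance of the metric; it lets every estimate below be phrased as
  smallness of a difference.\<close>

lemma dist_circle_eq_dist_0: "dist x y = dist (x - y) 0" for x y :: circle
proof -
  obtain a b where "x = to_circle a" "y = to_circle b"
    by (metis surjD[OF surj_to_circle])
  then show ?thesis
    by (metis diff_zero dist_to_circle to_circle_0 to_circle_diff)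
qed

lemma dist_circle_diff_le: "dist (a - b) (c - d) \<le> dist a c + dist b d" for a b c d :: circle
proof -
  have "dist (a - b) (c - b) = dist a c"
    using dist_circle_eq_dist_0[of "a - b" "c - b"] dist_circle_eq_dist_0[of a c] by simp
  moreover have "dist (c - b) (c - d) = dist d b"
    using dist_circle_eq_dist_0[of "c - b" "c - d"] dist_circle_eq_dist_0[of d b] by simp
  ultimately show ?thesis
    using dist_triangle[of "a - b" "c - d" "c - b"] by (simp add: dist_commute)
qed

lemma continuous_on_circle_diff [continuous_intros]:
  fixes f g :: "'a::topological_space \<Rightarrow> circle"
  assumes "continuous_on A f" "continuous_on A g"
  shows "continuous_on A (\<lambda>x. f x - g x)"
  unfolding continuous_on_def
proof
  fix x assume x: "x \<in> A"
  have "(f \<longlongrightarrow> f x) (at x within A)" "(g \<longlongrightarrow> g x) (at x within A)"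
    using assms x by (simp_all add: continuous_on_def)
  then have "((\<lambda>y. dist (f y) (f x) + dist (g y) (g x)) \<longlongrightarrow> 0) (at x within A)"
    unfolding tendsto_dist_iff[of f] tendsto_dist_iff[of g] by (rule tendsto_add_zero)
  then have "((\<lambda>y. dist (f y - g y) (f x - g x)) \<longlongrightarrow> 0) (at x within A)"
    by (rule Lim_null_comparison[rotated]) (simp add: dist_circle_diff_le)
  then show "((\<lambda>y. f y - g y) \<longlongrightarrow> f x - g x) (at x within A)"
    by (subst tendsto_dist_iff)
qed

lemma continuous_on_circle_add [continuous_intros]:
  fixes f g :: "'a::topological_space \<Rightarrow> circle"
  assumes "continuous_on A f" "continuous_on A g"
  shows "continuous_on A (\<lambda>x. f x + g x)"
  using continuous_on_circle_diff[OF assms(1) continuous_on_circle_diff[OF continuous_on_const[of _ 0] assms(2)]]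
  by simp

text \<open>The representative in \<open>[-1/2, 1/2)\<close>; it is discontinuous at the class of \<open>1/2\<close>.\<close>

lift_definition circle_rep :: "circle \<Rightarrow> real" is "\<lambda>x. x - of_int (round x)"
proof -
  fix x y :: real
  assume "x - y \<in> \<int>"
  then obtain m where "x = y + of_int m"
    by (metis Ints_cases add.commute diff_add_cancel)
  then show "x - of_int (round x) = y - of_int (round y)"
    using floor_add_int[of "y + 1/2" m] by (simp add: round_def algebra_simps)
qed

lemma to_circle_circle_rep [simp]: "to_circle (circle_rep c) = c"
  by transfer simp

lemma abs_circle_rep: "\<bar>circle_rep c\<bar> = dist c 0"
  by transfer simp

text \<open>Representatives of two points of this ball differ by less than 1/2, so the integer
  nearest to their difference is 0 and \<open>circle_rep\<close> is an isometry there.\<close>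

lemma continuous_on_circle_rep: "continuous_on (ball 0 (1/4)) circle_rep"
  unfolding continuous_on_iff
proof safe
  fix u :: circle and e :: real assume u: "u \<in> ball 0 (1/4)" and e: "e > 0"
  have "dist (circle_rep v) (circle_rep u) = dist v u" if v: "v \<in> ball 0 (1/4)" for v
  proof -
    have "\<bar>circle_rep v - circle_rep u\<bar> < 1/2"
      using u v abs_circle_rep[of u] abs_circle_rep[of v]
      unfolding mem_ball dist_commute[of 0] by linarith
    then have "round (circle_rep v - circle_rep u) = 0"
      by (intro round_unique') simp
    then show ?thesis
      using dist_to_circle[of "circle_rep v" "circle_rep u"] by (simp add: dist_real_def)
  qed
  with e show "\<exists>d>0. \<forall>x'\<in>ball 0 (1/4). dist x' u < d \<longrightarrow> dist (circle_rep x') (circle_rep u) < e"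
    by metis
qed

section \<open>Recurrence of the irrational rotation\<close>

text \<open>Forward orbits of the rotation are dense, so the open sets \<open>U k\<close> of points
  that are near \<open>\<theta>\<^sub>0\<close> at time \<open>k\<close> cover the circle. A finite
  subcover bounds the time.\<close>

lemma bounded_entrance_time:
  assumes "\<omega> \<notin> \<rat>" "\<delta> > 0"
  obtains N :: nat where "\<And>\<theta>. \<exists>k\<le>N. dist (\<theta> + to_circle (real k * \<omega>)) \<theta>\<^sub>0 < \<delta>"
proof -
  define U where "U k = {\<theta>. dist (\<theta> + to_circle (real k * \<omega>)) \<theta>\<^sub>0 < \<delta>}" for k :: nat
  have op: "open (U k)" for k
    unfolding U_def by (intro open_Collect_less continuous_intros)
  have cover: "\<exists>k. \<theta> \<in> U k" for \<theta>
  proof -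
    obtain \<alpha> where \<alpha>: "\<theta>\<^sub>0 - \<theta> = to_circle \<alpha>"
      by (metis surjD[OF surj_to_circle])
    \<comment> \<open>The density statement provides a positive \<open>k\<close>, hence a genuine
      forward time; the integer \<open>h\<close> vanishes on the circle.\<close>
    obtain h k where hk: "k > 0" "\<bar>of_int k * \<omega> - of_int h - \<alpha>\<bar> < \<delta>"
      by (rule sequence_of_fractional_parts_is_dense[OF assms])
    have "to_circle (real (nat k) * \<omega>) = to_circle (of_int k * \<omega> - of_int h)"
      using hk(1) by (simp add: to_circle_diff)
    then have "dist (to_circle (real (nat k) * \<omega>)) (to_circle \<alpha>) < \<delta>"
      using dist_to_circle_le[of "of_int k * \<omega> - of_int h" \<alpha>] hk(2) by (simp add: dist_real_def)
    moreover have "dist (\<theta> + c) \<theta>\<^sub>0 = dist c (to_circle \<alpha>)" for c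
    proof -
      have "\<theta> + c - \<theta>\<^sub>0 = c - (\<theta>\<^sub>0 - \<theta>)"
        by (simp add: algebra_simps)
      then show ?thesis
        using dist_circle_eq_dist_0[of "\<theta> + c" \<theta>\<^sub>0] dist_circle_eq_dist_0[of c "to_circle \<alpha>"]
        by (simp only: \<alpha>)
    qed
    ultimately have "\<theta> \<in> U (nat k)" unfolding U_def by simp
    then show ?thesis ..
  qed
  obtain K where K: "finite K" "UNIV \<subseteq> (\<Union>k\<in>K. U k)"
  proof (rule compactE_image[OF compact_UNIV_circle, of UNIV U])
    show "UNIV \<subseteq> (\<Union>k. U k)" using cover by blast
  qed (use op in auto)
  have "\<exists>k\<le>Max K. dist (\<theta> + to_circle (real k * \<omega>)) \<theta>\<^sub>0 < \<delta>" for \<theta>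
  proof -
    obtain k where "k \<in> K" "\<theta> \<in> U k"
      using K(2) by blast
    then show ?thesis
      using Max_ge[OF K(1)] by (auto simp: U_def)
  qed
  then show thesis by (rule that)
qed

section \<open>From a homotopy to a real displacement\<close>

text \<open>Uniform continuity on the compact cylinder makes the increments of the homotopy over
  short times smaller than 1/4, where \<open>circle_rep\<close> is continuous. Their representatives
  add up to a continuous function, and modulo integers the sum telescopes.\<close>

lemma homotopic_displacement:
  fixes f :: "circle \<times> circle \<Rightarrow> circle \<times> circle"
  assumes "homotopic_with_canon (\<lambda>_. True) UNIV UNIV f id"
  obtains \<Phi> :: "circle \<times> circle \<Rightarrow> real"
    where "continuous_on UNIV \<Phi>" "\<And>z. to_circle (\<Phi> z) = snd (f z) - snd z"
proof -
  obtain h where h: "continuous_on ({0..1::real} \<times> UNIV) h" "\<And>z. h (0, z) = f z" "\<And>z. h (1, z) = z"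
    using assms unfolding homotopic_with_def by (auto simp: prod_topology_subtopology)
  define g where "g t z = snd (h (t, z))" for t :: real and z
  have compact: "compact ({0..1::real} \<times> (UNIV :: (circle \<times> circle) set))"
    using compact_Times[OF compact_UNIV_circle compact_UNIV_circle]
    by (intro compact_Times) simp_all
  have "uniformly_continuous_on ({0..1} \<times> UNIV) (\<lambda>p. snd (h p))"
    by (rule compact_uniformly_continuous[OF continuous_on_snd[OF h(1)] compact])
  from this[unfolded uniformly_continuous_on_def, rule_format, of "1/4"]
  obtain \<delta> where \<delta>: "\<delta> > 0"
    "\<And>p q. p \<in> {0..1} \<times> UNIV \<Longrightarrow> q \<in> {0..1} \<times> UNIV \<Longrightarrow> dist q p < \<delta> \<Longrightarrow>
      dist (snd (h q)) (snd (h p)) < 1/4"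
    by (meson zero_less_divide_1_iff zero_less_numeral)
  obtain N :: nat where N: "N > 0" "1 / real N < \<delta>"
    using \<delta>(1) by (metis gr_zeroI inverse_eq_divide real_arch_inverse)
  have small: "dist (g (real i / real N) z - g (real (Suc i) / real N) z) 0 < 1/4" if "i < N" for i z
  proof -
    have "real (Suc i) / real N \<le> 1" "real i / real N \<le> 1"
      using that by simp_all
    moreover have "dist (real i / real N) (real (Suc i) / real N) < \<delta>"
      using N by (simp add: dist_real_def add_divide_distrib)
    ultimately show ?thesis
      unfolding g_def dist_circle_eq_dist_0[symmetric]
      by (intro \<delta>(2)) (auto simp: dist_Pair_Pair)
  qed
  have g_cont: "continuous_on UNIV (g t)" if "t \<in> {0..1}" for t
    unfolding g_def
    by (intro continuous_intros continuous_on_compose2[OF h(1)]) (use that in auto)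
  \<comment> \<open>Each term is the earlier time minus the later one, since the homotopy starts at
    \<open>f\<close> and ends at the identity.\<close>
  define \<Phi> where
    "\<Phi> z = (\<Sum>i<N. circle_rep (g (real i / real N) z - g (real (Suc i) / real N) z))" for z
  have "continuous_on UNIV \<Phi>"
    unfolding \<Phi>_def
  proof (intro continuous_on_sum continuous_on_compose2[OF continuous_on_circle_rep]
      continuous_on_circle_diff g_cont)
    fix i assume "i \<in> {..<N}"
    then show "real i / real N \<in> {0..1}" "real (Suc i) / real N \<in> {0..1}" by simp_all
    show "(\<lambda>z. g (real i / real N) z - g (real (Suc i) / real N) z) ` UNIV \<subseteq> ball 0 (1/4)"
      using small \<open>i \<in> {..<N}\<close> by (auto simp: dist_commute)
  qed
  moreover have "to_circle (\<Phi> z) = snd (f z) - snd z" for z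
  proof -
    have "to_circle (\<Sum>i<n. circle_rep (g (real i / real N) z - g (real (Suc i) / real N) z))
        = g 0 z - g (real n / real N) z" for n
      by (induction n) (simp_all add: to_circle_0 to_circle_add)
    from this[of N] show ?thesis
      using N(1) h(2,3) by (simp add: \<Phi>_def g_def)
  qed
  ultimately show thesis by (rule that)
qed

section \<open>Almost additive sequences\<close>

text \<open>Comparing \<open>a (m * n)\<close> with both \<open>m * a n\<close> and
  \<open>n * a m\<close> shows that every \<open>(a n - C) / n\<close> lies below every
  \<open>(a m + C) / m\<close>. The supremum of the former therefore separates the two
  families.\<close>

lemma almost_additive_linear:
  fixes a :: "nat \<Rightarrow> real"
  assumes "\<And>m n. \<bar>a (m + n) - a m - a n\<bar> \<le> C"
  obtains \<rho> where "\<And>n. \<bar>a n - real n * \<rho>\<bar> \<le> C"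
proof -
  have mult: "\<bar>a (Suc m * n) - real (Suc m) * a n\<bar> \<le> real m * C" for m n
  proof (induction m)
    case (Suc m)
    have "\<bar>a (Suc (Suc m) * n) - a n - a (Suc m * n)\<bar> \<le> C"
      using assms[of n "Suc m * n"] by (simp add: add.assoc)
    then show ?case
      using Suc.IH by (simp add: algebra_simps)
  qed simp
  have C: "C \<ge> 0" using assms[of 0 0] by linarith
  have mult': "\<bar>a (m * n) - real m * a n\<bar> \<le> real m * C" if "m > 0" for m n
    using mult[of "m - 1" n] that C by (simp add: algebra_simps of_nat_diff)
  have le: "(a n - C) / real n \<le> (a m + C) / real m" if "n > 0" "m > 0" for m n
  proof -
    have "real m * a n - real n * a m \<le> real m * C + real n * C"
      using mult'[of m n] mult'[of n m] that by (simp add: mult.commute[of n m])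
    then show ?thesis using that by (simp add: field_simps)
  qed
  define \<rho> where "\<rho> = (SUP n\<in>{0<..}. (a n - C) / real n)"
  have bdd: "bdd_above ((\<lambda>n. (a n - C) / real n) ` {0<..})"
    using le[of _ 1] by (auto intro!: bdd_aboveI)
  have "\<bar>a n - real n * \<rho>\<bar> \<le> C" for n
  proof (cases "n = 0")
    case True
    \<comment> \<open>No quotient is available here, but the hypothesis at (0, 0) reads
      \<open>\<bar>a 0\<bar> \<le> C\<close>.\<close>
    then show ?thesis using assms[of 0 0] by simp
  next
    case False
    then have n: "n > 0" by simp
    have "(a n - C) / real n \<le> \<rho>"
      unfolding \<rho>_def by (rule cSUP_upper) (use n bdd in auto)
    moreover have "\<rho> \<le> (a n + C) / real n"
      unfolding \<rho>_def by (rule cSUP_least) (use n le in auto)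
    ultimately show ?thesis
      using n by (simp add: field_simps abs_le_iff)
  qed
  then show thesis by (rule that)
qed

section \<open>Lifts given by a displacement function\<close>

text \<open>Placing the displacement on the torus, and not on circle times line, builds in that the
  lift commutes with integer translations of the fibres.\<close>

locale monotone_skew_lift =
  fixes \<omega> :: real and \<Phi> :: "circle \<times> circle \<Rightarrow> real"
  assumes irrational: "\<omega> \<notin> \<rat>"
    and continuous_\<Phi>: "continuous_on UNIV \<Phi>"
    and monotone: "x \<le> y \<Longrightarrow> x + \<Phi> (\<theta>, to_circle x) \<le> y + \<Phi> (\<theta>, to_circle y)"
begin

definition F :: "circle \<times> real \<Rightarrow> circle \<times> real"
  where "F z = (fst z + to_circle \<omega>, snd z + \<Phi> (fst z, to_circle (snd z)))"

definition disp :: "nat \<Rightarrow> circle \<times> real \<Rightarrow> real"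
  where "disp n z = snd ((F ^^ n) z) - snd z"

lemma fst_F: "fst (F z) = fst z + to_circle \<omega>"
  and snd_F: "snd (F z) = snd z + \<Phi> (fst z, to_circle (snd z))"
  by (simp_all add: F_def)

lemma continuous_F: "continuous_on UNIV F"
  unfolding F_def
  by (intro continuous_intros continuous_on_compose2[OF continuous_\<Phi>]) auto

lemma continuous_disp: "continuous_on UNIV (disp n)"
proof -
  have "continuous_on UNIV (F ^^ n)"
    by (induction n) (auto intro: continuous_on_compose2[OF continuous_F])
  then show ?thesis
    unfolding disp_def by (intro continuous_intros)
qed

lemma fst_iterate: "fst ((F ^^ n) z) = fst z + to_circle (real n * \<omega>)"
  by (induction n) (simp_all add: fst_F to_circle_0 to_circle_add algebra_simps)

lemma iterate_translate:
  "snd ((F ^^ n) (\<theta>, x + of_int k)) = snd ((F ^^ n) (\<theta>, x)) + of_int k"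
  by (induction n) (simp_all add: snd_F fst_iterate)

lemma iterate_mono: "x \<le> y \<Longrightarrow> snd ((F ^^ n) (\<theta>, x)) \<le> snd ((F ^^ n) (\<theta>, y))"
  by (induction n) (simp_all add: snd_F fst_iterate monotone)

text \<open>The point \<open>x\<close> lies between two consecutive integer translates of
  \<open>y\<close>, and the iterates preserve this order and these translates.\<close>

lemma disp_fibre: "\<bar>disp n (\<theta>, x) - disp n (\<theta>, y)\<bar> \<le> 1"
proof -
  define k where "k = \<lfloor>x - y\<rfloor>"
  have k: "y + of_int k \<le> x" "x \<le> y + of_int (k + 1)"
    unfolding k_def by linarith+
  have "snd ((F ^^ n) (\<theta>, y)) + of_int k \<le> snd ((F ^^ n) (\<theta>, x))"
    "snd ((F ^^ n) (\<theta>, x)) \<le> snd ((F ^^ n) (\<theta>, y)) + of_int (k + 1)"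
    using iterate_mono[OF k(1)] iterate_mono[OF k(2)] by (simp_all only: iterate_translate)
  with k show ?thesis
    unfolding disp_def by (simp add: abs_le_iff)
qed

lemma disp_add: "disp (m + n) z = disp n ((F ^^ m) z) + disp m z"
  by (simp add: disp_def add.commute[of m n] funpow_add)

lemma disp_le_linear:
  obtains M where "M \<ge> 0" "\<And>n z. \<bar>disp n z\<bar> \<le> real n * M"
proof -
  have "compact (UNIV :: (circle \<times> circle) set)"
    by (metis UNIV_Times_UNIV compact_Times compact_UNIV_circle)
  then have "bounded (range \<Phi>)"
    by (intro compact_imp_bounded compact_continuous_image continuous_\<Phi>)
  then obtain M where M: "\<And>z. \<bar>\<Phi> z\<bar> \<le> M"
    by (auto simp: bounded_iff)
  have "\<bar>disp n z\<bar> \<le> real n * M" for n z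
  proof (induction n)
    case (Suc n)
    have "\<bar>disp (Suc n) z - disp n z\<bar> \<le> M"
      using M by (simp add: disp_def snd_F)
    with Suc show ?case by (simp add: algebra_simps)
  qed (simp add: disp_def)
  moreover have "M \<ge> 0" using M[of undefined] by linarith
  ultimately show thesis by (rule that[rotated])
qed

text \<open>Any orbit is over the interval around \<open>\<theta>\<^sub>0\<close> after at most
  \<open>N\<close> steps. Starting there instead costs at most \<open>2 * (real N * M)\<close>,
  moving within the fibre to height \<open>x\<^sub>0\<close> costs 1, and moving the base point to
  \<open>\<theta>\<^sub>0\<close> costs \<open>B\<close>.\<close>

lemma bounded_oscillation:
  assumes "\<delta> > 0"
    and near: "\<And>n t. \<bar>t\<bar> < \<delta> \<Longrightarrow> \<bar>disp n (\<theta>\<^sub>0 + to_circle t, x\<^sub>0) - disp n (\<theta>\<^sub>0, x\<^sub>0)\<bar> \<le> B"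
  obtains C where "\<And>n z. \<bar>disp n z - disp n (\<theta>\<^sub>0, x\<^sub>0)\<bar> \<le> C"
proof -
  obtain M where M: "M \<ge> 0" "\<And>n z. \<bar>disp n z\<bar> \<le> real n * M"
    using disp_le_linear by blast
  obtain N where N: "\<And>\<theta>. \<exists>k\<le>N. dist (\<theta> + to_circle (real k * \<omega>)) \<theta>\<^sub>0 < \<delta>"
    using bounded_entrance_time[OF irrational assms(1)] by metis
  have "\<bar>disp n z - disp n (\<theta>\<^sub>0, x\<^sub>0)\<bar> \<le> 2 * (real N * M) + 1 + B" for n z
  proof -
    obtain k where k: "k \<le> N" "dist (fst z + to_circle (real k * \<omega>)) \<theta>\<^sub>0 < \<delta>"
      using N by blast
    define t where "t = circle_rep (fst z + to_circle (real k * \<omega>) - \<theta>\<^sub>0)"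
    have t: "\<bar>t\<bar> < \<delta>" "fst ((F ^^ k) z) = \<theta>\<^sub>0 + to_circle t"
      using k(2) dist_circle_eq_dist_0 by (simp_all add: t_def abs_circle_rep fst_iterate)
    have *: "(F ^^ k) z = (\<theta>\<^sub>0 + to_circle t, snd ((F ^^ k) z))"
      using t(2) by (simp add: prod_eq_iff)
    \<comment> \<open>The displacement over \<open>n + k\<close> steps is split in two ways, with
      the \<open>k\<close> steps first or last.\<close>
    have "disp n z - disp n ((F ^^ k) z) = disp k z - disp k ((F ^^ n) z)"
      using disp_add[of k n z] disp_add[of n k z] by (simp add: add.commute)
    moreover have "real k * M \<le> real N * M"
      using k(1) M(1) by (simp add: mult_right_mono)
    ultimately have "\<bar>disp n z - disp n ((F ^^ k) z)\<bar> \<le> 2 * (real N * M)"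
      using M(2)[of k z] M(2)[of k "(F ^^ n) z"] by linarith
    moreover have "\<bar>disp n ((F ^^ k) z) - disp n (\<theta>\<^sub>0 + to_circle t, x\<^sub>0)\<bar> \<le> 1"
      by (subst *) (rule disp_fibre)
    ultimately show ?thesis
      using near[OF t(1), of n] by linarith
  qed
  then show thesis by (rule that)
qed

text \<open>By the cocycle identity \<open>disp_add\<close>, replacing
  \<open>(F ^^ m) z\<^sub>0\<close> by \<open>z\<^sub>0\<close> makes the displacement along one
  orbit almost additive. Its slope is then the limit of the averages at every point, which is what
  identifies \<open>rotation_number F\<close>.\<close>

lemma bounded_deviation:
  assumes "\<And>n z. \<bar>disp n z - disp n z\<^sub>0\<bar> \<le> C"
  obtains C' where "\<And>n z. \<bar>disp n z - real n * rotation_number F\<bar> \<le> C'"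
proof -
  have "\<bar>disp (m + n) z\<^sub>0 - disp m z\<^sub>0 - disp n z\<^sub>0\<bar> \<le> C" for m n
    using assms[of n "(F ^^ m) z\<^sub>0"] by (simp add: disp_add)
  then obtain \<rho> where \<rho>: "\<And>n. \<bar>disp n z\<^sub>0 - real n * \<rho>\<bar> \<le> C"
    using almost_additive_linear[of "\<lambda>n. disp n z\<^sub>0" C] by blast
  have bound: "\<bar>disp n z - real n * \<rho>\<bar> \<le> 2 * C" for n z
    using \<rho>[of n] assms[of n z] by linarith
  have lim: "(\<lambda>n. disp n z / real n) \<longlonglongrightarrow> \<rho>" for z
  proof -
    have "(\<lambda>n. disp n z / real n - \<rho>) \<longlonglongrightarrow> 0"
    proof (rule Lim_null_comparison)
      show "(\<lambda>n. (2 * C) / real n) \<longlonglongrightarrow> 0"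
        by (rule lim_const_over_n)
      show "\<forall>\<^sub>F n in sequentially. norm (disp n z / real n - \<rho>) \<le> (2 * C) / real n"
        using eventually_gt_at_top[of 0]
      proof eventually_elim
        case (elim n)
        then have "disp n z / real n - \<rho> = (disp n z - real n * \<rho>) / real n"
          by (simp add: field_simps)
        with elim bound[of n z] show ?case
          by (simp add: divide_right_mono)
      qed
    qed
    then show ?thesis by (rule LIM_zero_cancel)
  qed
  have "rotation_number F = \<rho>"
    unfolding rotation_number_def
  proof (rule the_equality)
    show "\<forall>\<theta> \<xi>. (\<lambda>n. (snd ((F ^^ n) (\<theta>, \<xi>)) - \<xi>) / real n) \<longlonglongrightarrow> \<rho>"
      using lim[of "(_, _)"] by (simp add: disp_def)
    show "r = \<rho>" if "\<forall>\<theta> \<xi>. (\<lambda>n. (snd ((F ^^ n) (\<theta>, \<xi>)) - \<xi>) / real n) \<longlonglongrightarrow> r" for r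
      using that[rule_format, of 0 0] lim[of "(0, 0)"] unfolding disp_def snd_conv
      by (rule LIMSEQ_unique)
  qed
  with bound show thesis using that by blast
qed

end

section \<open>Continuity arguments on the real line\<close>

text \<open>A continuous injection of the line is strictly increasing or strictly decreasing, and
  one pair of values decides which.\<close>

lemma continuous_fibre_mono:
  fixes g :: "real \<Rightarrow> real"
  assumes "continuous_on UNIV g" "inj g" "g 0 < g 1" "x \<le> y"
  shows "g x \<le> g y"
proof -
  have "strict_mono_on UNIV g \<or> strict_antimono_on UNIV g"
    using injective_eq_monotone_map[OF is_interval_univ assms(1)] assms(2) by (rule iffD1)
  moreover have "\<not> strict_antimono_on UNIV g"
    using assms(3) monotone_onD[of UNIV "(<)" "(>)" g 0 1] by auto
  ultimately have "strict_mono g" by blast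
  then show ?thesis
    using assms(4) by (simp add: strict_mono_less_eq)
qed

text \<open>Closeness on the circle only says that \<open>D\<close> is near some integer. To leave
  the integer 0, where it starts, \<bar>D\<bar> would have to pass through 1/2, which is too far
  from all integers.\<close>

lemma small_near_integers_imp_small:
  fixes D :: "real \<Rightarrow> real"
  assumes "continuous_on UNIV D" "D 0 = 0"
    and near: "\<And>s. \<bar>s\<bar> < \<delta> \<Longrightarrow> dist (to_circle (D s)) 0 \<le> 1/4"
    and t: "\<bar>t\<bar> < \<delta>"
  shows "\<bar>D t\<bar> \<le> 1/4"
proof (rule ccontr)
  assume "\<not> \<bar>D t\<bar> \<le> 1/4"
  moreover have dist: "dist (to_circle y) 0 = \<bar>y - of_int (round y)\<bar>" for y
    using dist_to_circle[of y 0] by (simp add: to_circle_0)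
  ultimately have "round (D t) \<noteq> 0"
    using near[OF t] by auto
  then have big: "\<bar>D t\<bar> \<ge> 1/2"
    using round_unique'[of "D t" 0] by fastforce
  have "connected ((\<lambda>s. \<bar>D s\<bar>) ` closed_segment 0 t)"
    by (intro connected_continuous_image continuous_intros continuous_on_subset[OF assms(1)]) auto
  then have "1/2 \<in> (\<lambda>s. \<bar>D s\<bar>) ` closed_segment 0 t"
    by (rule connectedD_interval[where x = "\<bar>D 0\<bar>" and y = "\<bar>D t\<bar>"]) (use big assms(2) in auto)
  then obtain s where s: "s \<in> closed_segment 0 t" "\<bar>D s\<bar> = 1/2" by auto
  have "\<bar>s\<bar> < \<delta>"
    using s(1) t by (auto simp: closed_segment_eq_real_ivl split: if_splits)
  from near[OF this] have "\<bar>D s - of_int (round (D s))\<bar> \<le> 1/4" by (simp add: dist)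
  \<comment> \<open>Ties are rounded up, so 1/2 goes to 1 and -1/2 goes to 0; the distance is 1/2
    either way.\<close>
  moreover have "\<bar>x - of_int (round x)\<bar> = 1/2" if "\<bar>x\<bar> = 1/2" for x :: real
  proof -
    consider "x = 1/2" | "x = -1/2" using \<open>\<bar>x\<bar> = 1/2\<close> by linarith
    then show ?thesis by cases (simp_all only: round_def, simp_all)
  qed
  ultimately show False using s(2) by fastforce
qed

section \<open>Failure of sensitivity bounds the deviations\<close>

theorem proposition4p3:
  fixes \<omega> :: real and f :: "circle \<times> circle \<Rightarrow> circle \<times> circle"
  assumes "qpf_circle_homeo \<omega> f"
    and "homotopic_with_canon (\<lambda>_. True) UNIV UNIV f id"
    and "rho_unbounded f"
  shows "sensitive_dependence f"
proof (rule ccontr)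
  assume not_sensitive: "\<not> sensitive_dependence f"
  have irr: "\<omega> \<notin> \<rat>" and base: "\<And>\<theta> \<xi>. fst (f (\<theta>, \<xi>)) = \<theta> + to_circle \<omega>"
    and homeo: "\<And>\<theta>. \<exists>h. homeomorphism UNIV UNIV (\<lambda>\<xi>. snd (f (\<theta>, \<xi>))) h"
    using assms(1) unfolding qpf_circle_homeo_def by auto
  have inj: "inj (\<lambda>\<xi>. snd (f (\<theta>, \<xi>)))" for \<theta>
  proof -
    obtain h where "homeomorphism UNIV UNIV (\<lambda>\<xi>. snd (f (\<theta>, \<xi>))) h"
      using homeo by blast
    then show ?thesis
      by (intro inj_on_inverseI[where g = h]) (simp add: homeomorphism_def)
  qed
  obtain \<Phi> where \<Phi>: "continuous_on UNIV \<Phi>" "\<And>z. to_circle (\<Phi> z) = snd (f z) - snd z"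
    using homotopic_displacement[OF assms(2)] by blast
  interpret monotone_skew_lift \<omega> \<Phi>
  proof
    fix x y :: real and \<theta> assume "x \<le> y"
    define g where "g x = x + \<Phi> (\<theta>, to_circle x)" for x
    have to_g: "to_circle (g x) = snd (f (\<theta>, to_circle x))" for x
      by (simp add: g_def to_circle_add \<Phi>(2))
    have "continuous_on UNIV g"
      unfolding g_def by (intro continuous_intros continuous_on_compose2[OF \<Phi>(1)]) auto
    \<comment> \<open>Injectivity of the fibre map gives the same circle point, hence the same value
      of \<Phi>, which then cancels.\<close>
    moreover have "inj g"
    proof
      fix a b assume "g a = g b"
      then have "to_circle a = to_circle b"
        using to_g inj by (metis injD)
      with \<open>g a = g b\<close> show "a = b" by (simp add: g_def)
    qed
    \<comment> \<open>As 0 and 1 are the same circle point, \<open>g 1 = g 0 + 1\<close>; this is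
      where the orientation is fixed.\<close>
    moreover have "g 0 < g 1"
      using to_circle_of_int[of 1] by (simp add: g_def to_circle_0)
    ultimately show "x + \<Phi> (\<theta>, to_circle x) \<le> y + \<Phi> (\<theta>, to_circle y)"
      using continuous_fibre_mono \<open>x \<le> y\<close> unfolding g_def by blast
  qed (fact irr \<Phi>(1))+
  have lift: "f (fst z, to_circle (snd z)) = (fst (F z), to_circle (snd (F z)))" for z
    by (rule prod_eqI) (simp_all add: F_def base to_circle_add \<Phi>(2))
  then have is_lift: "is_lift F f"
    unfolding is_lift_def using continuous_F by (auto simp: fun_eq_iff map_prod_def case_prod_beta)
  have "(f ^^ n) (\<theta>, to_circle x) = (fst ((F ^^ n) (\<theta>, x)), to_circle (snd ((F ^^ n) (\<theta>, x))))" for n \<theta> x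
    by (induction n) (simp_all add: lift)
  then have lift_iterate: "to_circle (snd ((F ^^ n) (\<theta>, x))) = snd ((f ^^ n) (\<theta>, to_circle x))" for n \<theta> x
    by simp
  obtain \<delta> p where \<delta>: "\<delta> > 0" "\<And>n y. dist p y < \<delta> \<Longrightarrow> dist ((f ^^ n) p) ((f ^^ n) y) \<le> 1/4"
  proof -
    \<comment> \<open>Failure at the single scale 1/4 suffices: it yields one point and one radius
      that serve all times \<open>n\<close> at once.\<close>
    have "\<not> (\<forall>\<delta>>0. \<forall>p. \<exists>n y. dist p y < \<delta> \<and> dist ((f ^^ n) p) ((f ^^ n) y) > 1/4)"
      using not_sensitive[unfolded sensitive_dependence_def not_ex, rule_format, of "1/4"] by auto
    then show thesis using that by (meson not_le)
  qed
  obtain \<theta>\<^sub>0 x\<^sub>0 where p: "p = (\<theta>\<^sub>0, to_circle x\<^sub>0)"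
    using surjD[OF surj_to_circle, of "snd p"] by (cases p) auto
  \<comment> \<open>Only the base point varies, along a real parameter, so that continuity can keep
    the lifted difference near 0; \<delta> does not depend on \<open>n\<close>.\<close>
  have near: "\<bar>disp n (\<theta>\<^sub>0 + to_circle t, x\<^sub>0) - disp n (\<theta>\<^sub>0, x\<^sub>0)\<bar> \<le> 1/4" if "\<bar>t\<bar> < \<delta>" for n t
  proof (rule small_near_integers_imp_small[OF _ _ _ that])
    show "continuous_on UNIV (\<lambda>s. disp n (\<theta>\<^sub>0 + to_circle s, x\<^sub>0) - disp n (\<theta>\<^sub>0, x\<^sub>0))"
      by (intro continuous_intros continuous_on_compose2[OF continuous_disp]) auto
    show "disp n (\<theta>\<^sub>0 + to_circle 0, x\<^sub>0) - disp n (\<theta>\<^sub>0, x\<^sub>0) = 0"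
      by (simp add: to_circle_0)
    fix s assume s: "\<bar>s\<bar> < \<delta>"
    let ?y = "(\<theta>\<^sub>0 + to_circle s, to_circle x\<^sub>0)"
    have "dist p ?y \<le> \<bar>s\<bar>"
      using dist_circle_eq_dist_0[of "\<theta>\<^sub>0 + to_circle s" \<theta>\<^sub>0] dist_to_circle_le[of s 0]
      by (simp add: p dist_Pair_Pair dist_commute to_circle_0)
    then have "dist ((f ^^ n) ?y) ((f ^^ n) p) \<le> 1/4"
      using \<delta>(2)[of ?y n] s by (simp add: dist_commute)
    then have "dist (snd ((f ^^ n) ?y)) (snd ((f ^^ n) p)) \<le> 1/4"
      using dist_snd_le order_trans by blast
    \<comment> \<open>Both orbits start at height \<open>x\<^sub>0\<close>, which cancels and leaves
      the difference of the second coordinates of the iterates of \<open>f\<close>.\<close>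
    then show "dist (to_circle (disp n (\<theta>\<^sub>0 + to_circle s, x\<^sub>0) - disp n (\<theta>\<^sub>0, x\<^sub>0))) 0 \<le> 1/4"
      by (subst (asm) dist_circle_eq_dist_0) (simp add: disp_def to_circle_diff lift_iterate p)
  qed
  obtain C where "\<And>n z. \<bar>disp n z - disp n (\<theta>\<^sub>0, x\<^sub>0)\<bar> \<le> C"
    using bounded_oscillation[OF \<delta>(1) near] by blast
  then obtain C' where "\<And>n z. \<bar>disp n z - real n * rotation_number F\<bar> \<le> C'"
    using bounded_deviation by blast
  then have "\<bar>snd ((F ^^ n) (\<theta>, \<xi>)) - \<xi> - real n * rotation_number F\<bar> \<le> C'" for \<theta> \<xi> n
    unfolding disp_def by (metis snd_conv)
  then have "rho_bounded f"
    unfolding rho_bounded_def using is_lift by blast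
  with assms(3) show False by simp
qed

end
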